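(* If $r\in(1,2)$, then $$\frac{1}{r^{1/r}}<\sin_r\frac{\pi_r}{4};$$ if $r=2$, then $$\sin_2\frac{\pi_2}{4}=\frac{1}{\sqrt2};$$ and if $r\in(2,\infty)$, then $$\sin_r\frac{\pi_r}{4}<\frac{1}{r^{1/r}}.$$
   Context: For $r\in(1,\infty)$ define $\sin_r^{-1}x:=\int_0^x(1-t^r)^{-1/r}\,dt$ for $0\le x\le1$ and $\pi_r:=2\sin_r^{-1}1$. The function $\sin_r:[0,\pi_r/2]\to[0,1]$ is the (increasing) inverse function of $\sin_r^{-1}$. *)

theory Defs
  imports "HOL-Analysis.Analysis"
begin

(* At x = 1 the integral is improper. The Henstock-Kurzweil integral over the closed interval
   still gives its value: the integrand is nonnegative and integrable, and its value at the
   single point t = 1 (which is 0, as 0 powr a = 0) is irrelevant. *)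
definition arcsin_gen :: "real \<Rightarrow> real \<Rightarrow> real" where
  "arcsin_gen r x = integral {0..x} (\<lambda>t. (1 - t powr r) powr (- (1 / r)))"

definition pi_gen :: "real \<Rightarrow> real" where
  "pi_gen r = 2 * arcsin_gen r 1"

(* Meaningful for y in {0..pi_gen r / 2}, the image of {0..1} under arcsin_gen r (1 < r). *)
definition sin_gen :: "real \<Rightarrow> real \<Rightarrow> real" where
  "sin_gen r y = the_inv_into {0..1} (arcsin_gen r) y"

end

theory Submission
  imports Defs
begin

text \<open>
Put p = 1 / r. The substitution u = t powr r turns the integrand of arcsin_gen r into 1 / r times
the beta density u powr (p - 1) * (1 - u) powr (-p) on (0, 1), whose mean is p. The point
1 / r powr (1 / r) corresponds to u = p, whereas sin_gen r (pi_gen r / 4) halves the integral over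
(0, 1), so it corresponds to the median. The theorem therefore compares the mean and the
median of this beta distribution: the mean is the larger one for p < 1/2, the smaller one for
p > 1/2, and they agree for p = 1/2.

For p < 1/2 write g for the density. The density is larger on the left of its mean than at the
mirror image on the right: g (p + s) < g (p - s) for 0 < s < p
(beta_density_reflect_about_mean_less). Reflection about p then gives
\<integral> u g(u) over (0, p) > \<integral> (2p - u) g(u) over (p, 2p) >
\<integral> (2p - u) g(u) over (p, 1),
the last step because 2p - u is negative beyond 2p. Since p is the mean, the deviations p - u on
the left and u - p on the right integrate to the same number; adding it to both ends
leaves p \<integral> g over (0, p) > p \<integral> g over (p, 1), which says that the median lies
below p (beta_mean_above_median). The reflection u \<mapsto> 1 - u exchanges p and 1 - p. It
yields the case p > 1/2 from this one, and for p = 1/2 it is a symmetry of the density.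
\<close>

section \<open>The density about its mean\<close>

definition beta_density :: "real \<Rightarrow> real \<Rightarrow> real" where
  "beta_density p u = u powr (p - 1) * (1 - u) powr (- p)"

lemma beta_density_pos: "0 < u \<Longrightarrow> u < 1 \<Longrightarrow> 0 < beta_density p u"
  by (simp add: beta_density_def)

lemma beta_density_reflect: "beta_density p (1 - u) = beta_density (1 - p) u"
  by (simp add: beta_density_def)

text \<open>
The logarithm \<phi> of g (p + s) / g (p - s) vanishes at s = 0, and its derivative is
2p(1 - p) (1 / ((1 - p)^2 - s^2) - 1 / (p^2 - s^2)), which is negative because p < 1 - p.
\<close>
lemma beta_density_reflect_about_mean_less:
  fixes p s :: real
  assumes p: "p < 1/2" and s: "0 < s" "s < p"
  shows "beta_density p (p + s) < beta_density p (p - s)"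
proof -
  define \<phi> where "\<phi> = (\<lambda>x. (p - 1) * (ln (p + x) - ln (p - x)) - p * (ln (1 - p - x) - ln (1 - p + x)))"
  have "\<phi> s < \<phi> 0"
  proof (rule DERIV_neg_imp_decreasing_open[OF s(1)])
    fix x assume x: "0 < x" "x < s"
    have pos: "p + x > 0" "p - x > 0" "1 - p - x > 0" "1 - p + x > 0"
      using x s p by auto
    have "(\<phi> has_real_derivative
        (p - 1) * (1 / (p + x) + 1 / (p - x)) + p * (1 / (1 - p - x) + 1 / (1 - p + x))) (at x)"
      unfolding \<phi>_def using pos
      by (auto intro!: derivative_eq_intros simp: divide_inverse algebra_simps)
    moreover have "(p - 1) * (1 / (p + x) + 1 / (p - x)) + p * (1 / (1 - p - x) + 1 / (1 - p + x))
        = 2 * p * (1 - p) * (1 / ((1 - p - x) * (1 - p + x)) - 1 / ((p + x) * (p - x)))"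
    proof -
      have "1 / (p + x) + 1 / (p - x) = 2 * p / ((p + x) * (p - x))"
        "1 / (1 - p - x) + 1 / (1 - p + x) = 2 * (1 - p) / ((1 - p - x) * (1 - p + x))"
        using pos by (simp_all add: divide_simps)
      moreover have "(p - 1) * (2 * p / A) + p * (2 * (1 - p) / B) = 2 * p * (1 - p) * (1 / B - 1 / A)"
        for A B :: real
        by (simp add: divide_inverse algebra_simps)
      ultimately show ?thesis by (simp only:)
    qed
    moreover have "1 / ((1 - p - x) * (1 - p + x)) < 1 / ((p + x) * (p - x))"
    proof -
      have "(1 - p - x) * (1 - p + x) - (p + x) * (p - x) = 1 - 2 * p"
        by (simp add: algebra_simps)
      then have "(p + x) * (p - x) < (1 - p - x) * (1 - p + x)" using p by linarith
      then show ?thesis using pos by (intro divide_strict_left_mono) auto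
    qed
    ultimately show "\<exists>y. (\<phi> has_real_derivative y) (at x) \<and> y < 0"
      using p s by (auto intro!: exI mult_pos_neg)
  next
    show "continuous_on {0..s} \<phi>"
      unfolding \<phi>_def using p s by (auto intro!: continuous_intros)
  qed
  moreover have "beta_density p (p + s) = exp ((p - 1) * ln (p + s) - p * ln (1 - p - s))"
    "beta_density p (p - s) = exp ((p - 1) * ln (p - s) - p * ln (1 - p + s))"
    using p s by (auto simp: beta_density_def powr_def diff_diff_eq simp flip: exp_add)
  ultimately show ?thesis
    by (simp add: \<phi>_def algebra_simps)
qed

text \<open>
The integral over (0, u) of the deviation (p - v) g(v) from p. That it vanishes at both
endpoints says that p is the mean.
\<close>
definition beta_moment :: "real \<Rightarrow> real \<Rightarrow> real" where
  "beta_moment p u = u powr p * (1 - u) powr (1 - p)"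

lemma beta_moment_has_derivative:
  assumes "0 < u" "u < 1"
  shows "(beta_moment p has_real_derivative (p - u) * beta_density p u) (at u)"
proof -
  have eq: "u powr p = u * u powr (p - 1)" "(1 - u) powr (1 - p) = (1 - u) * (1 - u) powr (- p)"
    using assms by (simp_all add: powr_diff powr_minus field_simps)
  have "(beta_moment p has_real_derivative
      p * u powr (p - 1) * (1 - u) powr (1 - p) - u powr p * ((1 - p) * (1 - u) powr (- p))) (at u)"
    unfolding beta_moment_def using assms
    by (auto intro!: derivative_eq_intros)
  then show ?thesis
    by (rule DERIV_cong) (simp add: eq beta_density_def algebra_simps)
qed

lemma beta_moment_continuous_on:
  "0 < p \<Longrightarrow> p < 1 \<Longrightarrow> continuous_on {0..1} (beta_moment p)"
  unfolding beta_moment_def by (auto intro!: continuous_intros continuous_on_powr')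

section \<open>Mean and median\<close>

text \<open>
The integrals of the reflection argument are expressed through a primitive I of the density, so
that only derivatives have to be compared. Any primitive will do, which lets the lemma be
applied to a reflected primitive as well.
\<close>
lemma beta_mean_above_median:
  fixes I :: "real \<Rightarrow> real"
  assumes p: "0 < p" "p < 1/2"
    and cont: "continuous_on {0..1} I"
    and deriv: "\<And>u. 0 < u \<Longrightarrow> u < 1 \<Longrightarrow> (I has_real_derivative beta_density p u) (at u)"
  shows "I 0 + I 1 < 2 * I p"
proof -
  let ?G = "beta_moment p" and ?g = "beta_density p"
  \<comment> \<open>Primitives of u g(u) and (2p - u) g(u), the two integrands that the reflection
    about p compares.\<close>
  define J where "J = (\<lambda>u. p * I u - ?G u)"
  define L where "L = (\<lambda>u. p * I u + ?G u)"
  have J: "(J has_real_derivative u * ?g u) (at u)" if "0 < u" "u < 1" for u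
    unfolding J_def using that
    by (auto intro!: derivative_eq_intros deriv beta_moment_has_derivative simp: algebra_simps)
  have L: "(L has_real_derivative (2 * p - u) * ?g u) (at u)" if "0 < u" "u < 1" for u
    unfolding L_def using that
    by (auto intro!: derivative_eq_intros deriv beta_moment_has_derivative simp: algebra_simps)
  have contJ: "continuous_on {0..1} J" and contL: "continuous_on {0..1} L"
    unfolding J_def L_def using p
    by (auto intro!: continuous_intros cont beta_moment_continuous_on)
  \<comment> \<open>The reflection step: the integral of u g(u) over (p - s, p) exceeds that of
    (2p - u) g(u) over (p, p + s), by an amount that grows with s; here s = p.\<close>
  have "J (p - p) + L (p + p) < J (p - 0) + L (p + 0)"
  proof (rule DERIV_neg_imp_decreasing_open[OF p(1), where f = "\<lambda>s. J (p - s) + L (p + s)"])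
    fix s assume s: "0 < s" "s < p"
    have "((\<lambda>s. J (p - s)) has_real_derivative ((p - s) * ?g (p - s)) * (-1)) (at s)"
      using s p by (intro DERIV_chain2[OF J]) (auto intro!: derivative_eq_intros)
    moreover have "((\<lambda>s. L (p + s)) has_real_derivative ((2 * p - (p + s)) * ?g (p + s)) * 1) (at s)"
      using s p by (intro DERIV_chain2[OF L]) (auto intro!: derivative_eq_intros)
    ultimately have "((\<lambda>s. J (p - s) + L (p + s)) has_real_derivative
        (p - s) * (?g (p + s) - ?g (p - s))) (at s)"
      by (rule DERIV_cong[OF DERIV_add]) (simp add: algebra_simps)
    moreover have "(p - s) * (?g (p + s) - ?g (p - s)) < 0"
      using beta_density_reflect_about_mean_less[OF p(2) s] s by (intro mult_pos_neg) auto
    ultimately show "\<exists>y. ((\<lambda>s. J (p - s) + L (p + s)) has_real_derivative y) (at s) \<and> y < 0"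
      by blast
  next
    show "continuous_on {0..p} (\<lambda>s. J (p - s) + L (p + s))"
      using p by (intro continuous_on_add continuous_on_compose2[OF contJ]
          continuous_on_compose2[OF contL] continuous_intros) auto
  qed
  \<comment> \<open>Beyond 2p there is no mirror point, but there 2p - u is negative.\<close>
  moreover have "L 1 < L (2 * p)"
  proof (rule DERIV_neg_imp_decreasing_open[where f = L])
    fix u assume u: "2 * p < u" "u < 1"
    then have "(2 * p - u) * ?g u < 0"
      using p by (intro mult_neg_pos beta_density_pos) auto
    then show "\<exists>y. (L has_real_derivative y) (at u) \<and> y < 0"
      using L[of u] u p by auto
  next
    show "continuous_on {2 * p..1} L"
      using p by (intro continuous_on_subset[OF contL]) auto
  qed (use p in simp)
  moreover have "J 0 = p * I 0" "L 1 = p * I 1" "J p + L p = 2 * (p * I p)"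
    by (simp_all add: J_def L_def beta_moment_def)
  ultimately have "p * (I 0 + I 1) < p * (2 * I p)"
    by (simp add: algebra_simps mult_2)
  then show ?thesis using p by simp
qed

text \<open>
The sign keeps the reflected primitive increasing; it also turns I 0 + I 1 into its negative, so
inequalities between mean and median change direction under reflection.
\<close>
lemma beta_reflected_primitive:
  fixes I :: "real \<Rightarrow> real"
  assumes "continuous_on {0..1} I"
    and "\<And>u. 0 < u \<Longrightarrow> u < 1 \<Longrightarrow> (I has_real_derivative beta_density p u) (at u)"
  shows "continuous_on {0..1} (\<lambda>u. - I (1 - u))"
    and "0 < u \<Longrightarrow> u < 1 \<Longrightarrow>
      ((\<lambda>u. - I (1 - u)) has_real_derivative beta_density (1 - p) u) (at u)"
proof -
  show "continuous_on {0..1} (\<lambda>u. - I (1 - u))"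
    by (intro continuous_on_minus continuous_on_compose2[OF assms(1)] continuous_intros) auto
  assume u: "0 < u" "u < 1"
  have "((\<lambda>u. I (1 - u)) has_real_derivative beta_density p (1 - u) * (-1)) (at u)"
    using u by (intro DERIV_chain2[OF assms(2)]) (auto intro!: derivative_eq_intros)
  from DERIV_minus[OF this]
  show "((\<lambda>u. - I (1 - u)) has_real_derivative beta_density (1 - p) u) (at u)"
    by (simp add: beta_density_reflect)
qed

lemma beta_mean_below_median:
  fixes I :: "real \<Rightarrow> real"
  assumes p: "1/2 < p" "p < 1"
    and I: "continuous_on {0..1} I"
      "\<And>u. 0 < u \<Longrightarrow> u < 1 \<Longrightarrow> (I has_real_derivative beta_density p u) (at u)"
  shows "2 * I p < I 0 + I 1"
  using beta_mean_above_median[OF _ _ beta_reflected_primitive[OF I]] p by simp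

text \<open>
At p = 1/2 the density is symmetric, so a primitive and its reflection differ by a constant.
\<close>
lemma beta_mean_eq_median:
  fixes I :: "real \<Rightarrow> real"
  assumes I: "continuous_on {0..1} I"
      "\<And>u. 0 < u \<Longrightarrow> u < 1 \<Longrightarrow> (I has_real_derivative beta_density (1/2) u) (at u)"
  shows "2 * I (1/2) = I 0 + I 1"
proof -
  let ?D = "\<lambda>u. I u - (- I (1 - u))"
  have "?D (1/2) = ?D 0"
  proof (rule DERIV_isconst2[where f = ?D and b = 1])
    show "continuous_on {0..1} ?D"
      by (intro continuous_on_diff I beta_reflected_primitive[OF I])
    fix u :: real assume u: "0 < u" "u < 1"
    show "(?D has_real_derivative 0) (at u)"
      using DERIV_diff[OF I(2)[OF u] beta_reflected_primitive(2)[OF I u]] by simp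
  qed auto
  then show ?thesis by simp
qed

section \<open>The generalised sine as an inverse function\<close>

locale sin_exponent =
  fixes r :: real
  assumes r: "1 < r"
begin

abbreviation integrand :: "real \<Rightarrow> real" where
  "integrand t \<equiv> (1 - t powr r) powr (- (1 / r))"

lemma powr_less_one: "0 \<le> t \<Longrightarrow> t < 1 \<Longrightarrow> t powr r < 1"
  using powr_less_mono2[of r t 1] r by simp

lemma integrand_continuous_on: "continuous_on {0..<1} integrand"
  using powr_less_one r by (auto intro!: continuous_intros continuous_on_powr' simp: less_le)

text \<open>
The singularity at 1 is dominated by that of (1 - t) powr (- (1 / r)), because t powr r \<le> t;
the latter has a primitive that is continuous up to 1, as 1 / r < 1.
\<close>
lemma integrand_integrable: "integrand integrable_on {0..1}"
proof -
  define q where "q = 1 - 1 / r"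
  have q: "0 < q" using r by (simp add: q_def)
  have "((\<lambda>t. (1 - t) powr (- (1 / r))) has_integral (- ((1 - 1) powr q / q) - - ((1 - 0) powr q / q))) {0..1}"
  proof (rule fundamental_theorem_of_calculus_interior)
    show "continuous_on {0..1} (\<lambda>t. - ((1 - t) powr q / q))"
      using q by (auto intro!: continuous_intros continuous_on_powr')
    fix t :: real assume t: "t \<in> {0<..<1}"
    then have "((\<lambda>t. - ((1 - t) powr q / q)) has_real_derivative (1 - t) powr (- (1 / r))) (at t)"
      using q by (auto intro!: derivative_eq_intros simp: q_def)
    then show "((\<lambda>t. - ((1 - t) powr q / q)) has_vector_derivative (1 - t) powr (- (1 / r))) (at t)"
      by (simp add: has_real_derivative_iff_has_vector_derivative)
  qed simp
  then have maj: "(\<lambda>t. (1 - t) powr (- (1 / r))) integrable_on {0<..<1}"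
    by (auto simp: integrable_on_def has_integral_Icc_iff_Ioo)
  have "integrand integrable_on {0<..<1}"
  proof (rule measurable_bounded_by_integrable_imp_integrable[OF _ maj])
    show "integrand \<in> borel_measurable (lebesgue_on {0<..<1})"
      by (intro continuous_imp_measurable_on_sets_lebesgue continuous_on_subset[OF integrand_continuous_on]) auto
    fix t :: real assume t: "t \<in> {0<..<1}"
    have "t powr r \<le> t powr 1"
      using t r by (intro powr_mono') auto
    then show "norm (integrand t) \<le> (1 - t) powr (- (1 / r))"
      using t r by (auto intro!: powr_mono2')
  qed auto
  then show ?thesis by (simp add: integrable_on_def has_integral_Icc_iff_Ioo)
qed

lemma arcsin_gen_continuous_on: "continuous_on {0..1} (arcsin_gen r)"
  unfolding arcsin_gen_def by (rule indefinite_integral_continuous_1[OF integrand_integrable])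

lemma arcsin_gen_has_derivative:
  assumes "0 < x" "x < 1"
  shows "(arcsin_gen r has_real_derivative integrand x) (at x)"
proof -
  obtain b where b: "x < b" "b < 1" using assms dense by blast
  have "continuous_on {0..b} integrand"
    using b by (intro continuous_on_subset[OF integrand_continuous_on]) auto
  then have "((\<lambda>y. integral {0..y} integrand) has_real_derivative integrand x) (at x within {0..b})"
    using b assms by (intro integral_has_real_derivative) auto
  moreover have "at x within {0..b} = at x"
    using b assms by (intro at_within_interior) auto
  ultimately show ?thesis by (simp add: arcsin_gen_def[abs_def])
qed

lemma arcsin_gen_strict_mono_on: "strict_mono_on {0..1} (arcsin_gen r)"
proof (rule strict_mono_onI)
  fix x y :: real assume xy: "x \<in> {0..1}" "y \<in> {0..1}" "x < y"
  show "arcsin_gen r x < arcsin_gen r y"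
  proof (rule DERIV_pos_imp_increasing_open[OF xy(3)])
    fix t assume t: "x < t" "t < y"
    with xy powr_less_one[of t] have "0 < integrand t" using r by simp
    then show "\<exists>z. (arcsin_gen r has_real_derivative z) (at t) \<and> 0 < z"
      using t xy arcsin_gen_has_derivative[of t] by auto
  next
    show "continuous_on {x..y} (arcsin_gen r)"
      using xy by (intro continuous_on_subset[OF arcsin_gen_continuous_on]) auto
  qed
qed

lemma arcsin_gen_0: "arcsin_gen r 0 = 0"
  by (simp add: arcsin_gen_def)

lemma sin_gen_inverse:
  assumes "0 \<le> y" "y \<le> pi_gen r / 2"
  shows "sin_gen r y \<in> {0..1}" and "arcsin_gen r (sin_gen r y) = y"
proof -
  have inj: "inj_on (arcsin_gen r) {0..1}"
    by (rule strict_mono_on_imp_inj_on[OF arcsin_gen_strict_mono_on])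
  have "\<exists>x. 0 \<le> x \<and> x \<le> 1 \<and> arcsin_gen r x = y"
    using assms arcsin_gen_continuous_on by (intro IVT') (auto simp: arcsin_gen_0 pi_gen_def)
  then have img: "y \<in> arcsin_gen r ` {0..1}" by auto
  show "sin_gen r y \<in> {0..1}"
    unfolding sin_gen_def by (rule the_inv_into_into[OF inj img order_refl])
  show "arcsin_gen r (sin_gen r y) = y"
    unfolding sin_gen_def by (rule f_the_inv_into_f[OF inj img])
qed

lemma pi_gen_pos: "0 < pi_gen r"
  using strict_mono_onD[OF arcsin_gen_strict_mono_on, of 0 1] by (simp add: arcsin_gen_0 pi_gen_def)

text \<open>
As arcsin_gen r is increasing, locating sin_gen r (pi_gen r / 4) amounts to
comparing values of arcsin_gen r with half of its total.
\<close>
lemma sin_gen_quarter_compare: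
  assumes "a \<in> {0..1}"
  shows "a < sin_gen r (pi_gen r / 4) \<longleftrightarrow> 2 * arcsin_gen r a < arcsin_gen r 1"
    and "sin_gen r (pi_gen r / 4) < a \<longleftrightarrow> arcsin_gen r 1 < 2 * arcsin_gen r a"
proof -
  let ?y = "sin_gen r (pi_gen r / 4)"
  have y: "?y \<in> {0..1}" "arcsin_gen r ?y = arcsin_gen r 1 / 2"
    using sin_gen_inverse[of "pi_gen r / 4"] pi_gen_pos by (auto simp: pi_gen_def)
  show "a < ?y \<longleftrightarrow> 2 * arcsin_gen r a < arcsin_gen r 1"
    using strict_mono_on_less[OF arcsin_gen_strict_mono_on assms y(1)] y(2) by auto
  show "?y < a \<longleftrightarrow> arcsin_gen r 1 < 2 * arcsin_gen r a"
    using strict_mono_on_less[OF arcsin_gen_strict_mono_on y(1) assms] y(2) by auto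
qed

section \<open>Substitution and conclusion\<close>

text \<open>
The primitive of the beta density with parameter 1 / r that the substitution u = t powr r
produces.
\<close>
definition beta_primitive :: "real \<Rightarrow> real" where
  "beta_primitive u = r * arcsin_gen r (u powr (1 / r))"

lemma beta_primitive_continuous_on: "continuous_on {0..1} beta_primitive"
  unfolding beta_primitive_def using r
  by (intro continuous_on_mult continuous_on_const continuous_on_compose2[OF arcsin_gen_continuous_on])
     (auto intro!: continuous_intros continuous_on_powr' powr_le1)

lemma beta_primitive_has_derivative:
  assumes u: "0 < u" "u < 1"
  shows "(beta_primitive has_real_derivative beta_density (1 / r) u) (at u)"
proof -
  have "u powr (1 / r) < 1"
    using powr_less_mono2[of "1 / r" u 1] u r by simp
  then have "((\<lambda>u. arcsin_gen r (u powr (1 / r))) has_real_derivative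
      integrand (u powr (1 / r)) * (1 / r * u powr (1 / r - 1))) (at u)"
    using u by (intro DERIV_chain2[OF arcsin_gen_has_derivative])
      (auto intro!: derivative_eq_intros)
  then have "(beta_primitive has_real_derivative
      r * (integrand (u powr (1 / r)) * (1 / r * u powr (1 / r - 1)))) (at u)"
    unfolding beta_primitive_def by (rule DERIV_cmult)
  moreover have "(u powr (1 / r)) powr r = u"
    using u r by (simp add: powr_powr)
  ultimately show ?thesis
    using r by (simp add: beta_density_def mult.commute)
qed

lemma beta_primitive_values:
  "beta_primitive 0 = 0" "beta_primitive 1 = r * arcsin_gen r 1"
  "beta_primitive (1 / r) = r * arcsin_gen r (1 / r powr (1 / r))"
  using r by (simp_all add: beta_primitive_def arcsin_gen_0 powr_divide)

lemma mean_in_unit: "1 / r powr (1 / r) \<in> {0..1}"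
  using r by (simp add: ge_one_powr_ge_zero)

end

theorem corollary2p3:
  fixes r :: real
  shows "(r \<in> {1<..<2} \<longrightarrow> 1 / r powr (1 / r) < sin_gen r (pi_gen r / 4)) \<and>
         (r = 2 \<longrightarrow> sin_gen 2 (pi_gen 2 / 4) = 1 / sqrt 2) \<and>
         (r \<in> {2<..} \<longrightarrow> sin_gen r (pi_gen r / 4) < 1 / r powr (1 / r))"
proof (intro conjI impI)
  assume "r \<in> {1<..<2}"
  then interpret sin_exponent r by unfold_locales simp
  have "2 * beta_primitive (1 / r) < beta_primitive 0 + beta_primitive 1"
    using \<open>r \<in> {1<..<2}\<close>
    by (intro beta_mean_below_median beta_primitive_continuous_on beta_primitive_has_derivative) auto
  then have "r * (2 * arcsin_gen r (1 / r powr (1 / r))) < r * arcsin_gen r 1"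
    by (simp add: beta_primitive_values)
  then show "1 / r powr (1 / r) < sin_gen r (pi_gen r / 4)"
    using r sin_gen_quarter_compare(1)[OF mean_in_unit] by simp
next
  interpret sin_exponent 2 by unfold_locales simp
  have "2 * beta_primitive (1 / 2) = beta_primitive 0 + beta_primitive 1"
    by (intro beta_mean_eq_median beta_primitive_continuous_on beta_primitive_has_derivative) auto
  then have "2 * arcsin_gen 2 (1 / 2 powr (1 / 2)) = arcsin_gen 2 1"
    unfolding beta_primitive_values by simp
  then have "sin_gen 2 (pi_gen 2 / 4) = 1 / 2 powr (1 / 2)"
    using sin_gen_quarter_compare[OF mean_in_unit] by (metis less_irrefl linorder_less_linear)
  then show "sin_gen 2 (pi_gen 2 / 4) = 1 / sqrt 2"
    by (simp add: powr_half_sqrt)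
next
  assume "r \<in> {2<..}"
  then interpret sin_exponent r by unfold_locales simp
  have "beta_primitive 0 + beta_primitive 1 < 2 * beta_primitive (1 / r)"
    using \<open>r \<in> {2<..}\<close>
    by (intro beta_mean_above_median beta_primitive_continuous_on beta_primitive_has_derivative) auto
  then have "r * arcsin_gen r 1 < r * (2 * arcsin_gen r (1 / r powr (1 / r)))"
    by (simp add: beta_primitive_values)
  then show "sin_gen r (pi_gen r / 4) < 1 / r powr (1 / r)"
    using r sin_gen_quarter_compare(2)[OF mean_in_unit] by simp
qed

end
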